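(* Let $\Xi$ be a simple stationary Poisson cylinder process in $\mathbb{R}^d$ with $k$-dimensional direction spaces, intensity $\lambda$ and shape distribution $\theta$, and let $U_\Xi=\bigcup_{Z\in\Xi}Z$ be its union set. Then for every non-empty compact set $B\subset\mathbb{R}^d$ the capacity functional $T_{U_\Xi}(B)=\mathbf{P}(U_\Xi\cap B\neq\emptyset)$ is given by $$T_{U_\Xi}(B)=1-\exp\left\{-\lambda\int_{\mathcal{Z}_k^o}\nu_{d-k}^{L(Z)}\bigl(-K(Z)\oplus\pi_{L(Z)}(B)\bigr)\,\theta(\mathrm{d}Z)\right\}.$$
   Context: Let $0\le k\le d-1$ and let $G(k,d)$ be the Grassmannian of $k$-dimensional linear subspaces of $\mathbb{R}^d$. Let $\mathcal{R}$ be the convex ring, i.e. the family of finite unions of non-empty compact convex sets in $\mathbb{R}^d$ (Borel $\sigma$-algebra of the Hausdorff metric). A cylinder is a set $Z=K\oplus\xi$ (Minkowski sum) with direction space $\xi\in G(k,d)$ and base (cross-section) $K\in\mathcal{R}$, $K\subset\xi^\perp$; write $L(Z)=\xi$, $K(Z)=K$. $\mathcal{Z}_k$ is the set of all such cylinders, and $\mathcal{Z}_k^o\subset\mathcal{Z}_k$ is the set of those for which the midpoint of the circumsphere of $K(Z)$ is the origin. $\nu_{d-k}^{\xi}$ denotes $(d-k)$-dimensional Lebesgue measure on $\xi^\perp$; $\pi_\xi$ is the orthogonal projection along $\xi$ onto $\xi^\perp$; $-K=\{-x:x\in K\}$. A measure on $\mathcal{Z}_k$ is locally finite if for every compact $C\subset\mathbb{R}^d$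 the set of cylinders hitting $C$ has finite measure. A Poisson cylinder process $\Xi$ is a Poisson point process on $\mathcal{Z}_k$ with locally finite intensity measure $\Lambda$; it is simple if it has no multiple points (equivalently $\Lambda$ is diffuse). It is stationary if its distribution is invariant under translations of $\mathbb{R}^d$. In that case there are $\lambda\ge 0$ (the intensity) and a probability measure $\theta$ on $\mathcal{Z}_k^o$ (the shape distribution) such that, for every measurable $f\ge 0$, $$\int_{\mathcal{Z}_k}f\,\mathrm{d}\Lambda=\lambda\int_{\mathcal{Z}_k^o}\int_{L(Z)^\perp}f(\mathbf{x}+Z)\,\nu_{d-k}^{L(Z)}(\mathrm{d}\mathbf{x})\,\theta(\mathrm{d}Z).$$ Here $Z\in\Xi$ means that $Z$ lies in the support of $\Xi$; $U_\Xi$ is a random closed set. *)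

theory Defs
  imports "HOL-Probability.Probability"
begin

text \<open>Caution: on sets, \<open>A + B\<close> is the Minkowski sum, but \<open>- A\<close> is the complement;
  the reflection of \<open>A\<close> in the origin is \<open>uminus ` A\<close>.\<close>

definition grassmannian :: "nat \<Rightarrow> 'a::euclidean_space set set" where
  "grassmannian k = {\<xi>. subspace \<xi> \<and> dim \<xi> = k}"

text \<open>The union is over a non-empty family: the empty set has neither a Hausdorff distance
  nor a circumsphere, and \<open>{} + \<xi>\<close> would not determine \<open>\<xi>\<close>.\<close>

definition convex_ring :: "'a::euclidean_space set set" where
  "convex_ring =
    {\<Union>F | F. finite F \<and> F \<noteq> {} \<and> (\<forall>C\<in>F. C \<noteq> {} \<and> compact C \<and> convex C)}"

definition cylinders :: "nat \<Rightarrow> 'a::euclidean_space set set" where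
  "cylinders k = {K + \<xi> | K \<xi>. \<xi> \<in> grassmannian k \<and> K \<in> convex_ring \<and> K \<subseteq> \<xi>\<^sup>\<bottom>}"

definition direction :: "'a::euclidean_space set \<Rightarrow> 'a set" where
  "direction Z = (THE \<xi>. subspace \<xi> \<and> (\<exists>K\<in>convex_ring. K \<subseteq> \<xi>\<^sup>\<bottom> \<and> Z = K + \<xi>))"

definition cross_section :: "'a::euclidean_space set \<Rightarrow> 'a set" where
  "cross_section Z = Z \<inter> (direction Z)\<^sup>\<bottom>"

definition circumcenter :: "'a::euclidean_space \<Rightarrow> 'a set \<Rightarrow> bool" where
  "circumcenter c K \<longleftrightarrow>
    (\<exists>r. K \<subseteq> cball c r \<and> (\<forall>c' r'. K \<subseteq> cball c' r' \<longrightarrow> r \<le> r'))"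

definition centred_cylinders :: "nat \<Rightarrow> 'a::euclidean_space set set" where
  "centred_cylinders k = {Z \<in> cylinders k. circumcenter 0 (cross_section Z)}"

definition perp_proj :: "'a::euclidean_space set \<Rightarrow> 'a \<Rightarrow> 'a" where
  "perp_proj \<xi> x = (THE y. y \<in> \<xi>\<^sup>\<bottom> \<and> x - y \<in> \<xi>)"

text \<open>Lebesgue measure on a subspace \<open>V\<close>: the analogue of \<^const>\<open>lborel\<close>, which is the case
  \<open>V = UNIV\<close>, \<open>B = Basis\<close>. The choice of the orthonormal basis \<open>B\<close> is immaterial.\<close>

definition subspace_lborel :: "'a::euclidean_space set \<Rightarrow> 'a measure" where
  "subspace_lborel V =
    (let B = SOME B. B \<subseteq> V \<and> pairwise orthogonal B \<and> (\<forall>b\<in>B. norm b = 1) \<and> span B = V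
     in distr (\<Pi>\<^sub>M b\<in>B. lborel) (restrict_space borel V)
          (\<lambda>f. \<Sum>b\<in>B. f b *\<^sub>R b))"

text \<open>Outside the non-empty bounded sets the value is the dummy 0, since \<^locale>\<open>Metric_space\<close>
  asks for non-negativity and symmetry on the whole type.\<close>

definition hausdorff_dist :: "'a::euclidean_space set \<Rightarrow> 'a set \<Rightarrow> real" where
  "hausdorff_dist K L =
    (if K \<noteq> {} \<and> bounded K \<and> L \<noteq> {} \<and> bounded L
     then max (SUP x\<in>K. infdist x L) (SUP y\<in>L. infdist y K) else 0)"

text \<open>Hausdorff distance of the unit balls; on \<^term>\<open>grassmannian k\<close> it is a metric for the usual
  topology.\<close>

definition grassmannian_dist :: "'a::euclidean_space set \<Rightarrow> 'a set \<Rightarrow> real" where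
  "grassmannian_dist \<xi> \<eta> = hausdorff_dist (\<xi> \<inter> cball 0 1) (\<eta> \<inter> cball 0 1)"

definition borel_of_topology :: "'b topology \<Rightarrow> 'b measure" where
  "borel_of_topology X = sigma (topspace X) {U. openin X U}"

text \<open>A cylinder is identified with the pair of its direction space and its cross-section.\<close>

definition cylinder_algebra :: "nat \<Rightarrow> 'a::euclidean_space set measure" where
  "cylinder_algebra k =
    vimage_algebra (cylinders k) (\<lambda>Z. (direction Z, cross_section Z))
      (borel_of_topology
        (prod_topology (Metric_space.mtopology (grassmannian k) grassmannian_dist)
          (Metric_space.mtopology convex_ring hausdorff_dist)))"

text \<open>Sums of countably many Dirac measures: \<open>N = (\<Sum>i\<in>I. \<delta>\<^bsub>z i\<^esub>)\<close>, with repetitions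
  allowed.\<close>

definition counting_measures :: "'b measure \<Rightarrow> 'b measure set" where
  "counting_measures S =
    {distr (count_space I) S z | (I :: nat set) z. z \<in> I \<rightarrow> space S}"

definition counting_algebra :: "'b measure \<Rightarrow> 'b measure measure" where
  "counting_algebra S =
    (SUP A\<in>sets S. vimage_algebra (counting_measures S) (\<lambda>N. emeasure N A) borel)"

text \<open>If \<open>\<Lambda>\<close> gives infinite mass to \<open>A\<close>, the number of points in \<open>A\<close> is almost surely
  infinite.\<close>

definition poisson_process :: "'w measure \<Rightarrow> 'b measure \<Rightarrow> ('w \<Rightarrow> 'b measure) \<Rightarrow> bool" where
  "poisson_process M \<Lambda> \<Xi> \<longleftrightarrow>
    prob_space M \<and>
    \<Xi> \<in> M \<rightarrow>\<^sub>M counting_algebra \<Lambda> \<and>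
    (\<forall>A\<in>sets \<Lambda>.
      if emeasure \<Lambda> A = \<infinity> then AE \<omega> in M. emeasure (\<Xi> \<omega>) A = \<infinity>
      else \<forall>n::nat. measure M {\<omega> \<in> space M. emeasure (\<Xi> \<omega>) A = of_nat n} =
             measure \<Lambda> A ^ n / fact n * exp (- measure \<Lambda> A)) \<and>
    (\<forall>(m::nat) A. (\<forall>i<m. A i \<in> sets \<Lambda>) \<and> disjoint_family_on A {..<m} \<longrightarrow>
      prob_space.indep_vars M (\<lambda>_. borel) (\<lambda>i \<omega>. emeasure (\<Xi> \<omega>) (A i)) {..<m})"

definition support :: "'b measure \<Rightarrow> 'b set" where
  "support N = {z \<in> space N. emeasure N {z} > 0}"

definition simple_process :: "'w measure \<Rightarrow> ('w \<Rightarrow> 'b measure) \<Rightarrow> bool" where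
  "simple_process M \<Xi> \<longleftrightarrow> (AE \<omega> in M. \<forall>z \<in> space (\<Xi> \<omega>). emeasure (\<Xi> \<omega>) {z} \<le> 1)"

definition locally_finite :: "'a::euclidean_space set measure \<Rightarrow> bool" where
  "locally_finite \<Lambda> \<longleftrightarrow>
    (\<forall>C. compact C \<longrightarrow> emeasure \<Lambda> {Z \<in> space \<Lambda>. Z \<inter> C \<noteq> {}} < \<infinity>)"

definition poisson_cylinder_process ::
    "'w measure \<Rightarrow> nat \<Rightarrow> 'a::euclidean_space set measure \<Rightarrow> ('w \<Rightarrow> 'a set measure) \<Rightarrow> bool" where
  "poisson_cylinder_process M k \<Lambda> \<Xi> \<longleftrightarrow>
    sets \<Lambda> = sets (cylinder_algebra k) \<and> locally_finite \<Lambda> \<and> poisson_process M \<Lambda> \<Xi>"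

definition stationary ::
    "'w measure \<Rightarrow> nat \<Rightarrow> ('w \<Rightarrow> 'a::euclidean_space set measure) \<Rightarrow> bool" where
  "stationary M k \<Xi> \<longleftrightarrow>
    (\<forall>x::'a.
      distr M (counting_algebra (cylinder_algebra k))
        (\<lambda>\<omega>. distr (\<Xi> \<omega>) (cylinder_algebra k) (\<lambda>Z. (+) x ` Z)) =
      distr M (counting_algebra (cylinder_algebra k)) \<Xi>)"

definition intensity_and_shape ::
    "nat \<Rightarrow> 'a::euclidean_space set measure \<Rightarrow> real \<Rightarrow> 'a set measure \<Rightarrow> bool" where
  "intensity_and_shape k \<Lambda> l \<theta> \<longleftrightarrow>
    0 \<le> l \<and> prob_space \<theta> \<and>
    sets \<theta> = sets (restrict_space (cylinder_algebra k) (centred_cylinders k)) \<and>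
    (\<forall>f \<in> borel_measurable (cylinder_algebra k).
      (\<integral>\<^sup>+Z. f Z \<partial>\<Lambda>) =
      ennreal l * (\<integral>\<^sup>+Z. (\<integral>\<^sup>+x. f ((+) x ` Z) \<partial>subspace_lborel ((direction Z)\<^sup>\<bottom>)) \<partial>\<theta>))"

definition union_set :: "('w \<Rightarrow> 'a set measure) \<Rightarrow> 'w \<Rightarrow> 'a set" where
  "union_set \<Xi> \<omega> = \<Union>(support (\<Xi> \<omega>))"

definition capacity_functional :: "'w measure \<Rightarrow> ('w \<Rightarrow> 'a set) \<Rightarrow> 'a set \<Rightarrow> real" where
  "capacity_functional M U B = measure M {\<omega> \<in> space M. U \<omega> \<inter> B \<noteq> {}}"

lemma convex_ring_compact: "K \<in> convex_ring \<Longrightarrow> compact K"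
  unfolding convex_ring_def by auto

lemma convex_ring_nonempty: "K \<in> convex_ring \<Longrightarrow> K \<noteq> {}"
  unfolding convex_ring_def by auto

lemma perp_unique:
  fixes \<xi> :: "'a::euclidean_space set"
  assumes "subspace \<xi>" "y \<in> \<xi>\<^sup>\<bottom>" "x - y \<in> \<xi>" "y' \<in> \<xi>\<^sup>\<bottom>" "x - y' \<in> \<xi>"
  shows "y = y'"
proof -
  have 1: "y - y' \<in> \<xi>\<^sup>\<bottom>"
    using assms by (simp add: subspace_diff subspace_orthogonal_comp)
  have "(x - y') - (x - y) \<in> \<xi>"
    by (rule subspace_diff[OF assms(1) assms(5) assms(3)])
  then have 2: "y - y' \<in> \<xi>"
    by (simp add: algebra_simps)
  show ?thesis
    using 1 2 by (auto simp: orthogonal_comp_def orthogonal_def)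
qed

lemma perp_proj:
  fixes \<xi> :: "'a::euclidean_space set"
  assumes "subspace \<xi>"
  shows "perp_proj \<xi> x \<in> \<xi>\<^sup>\<bottom>" "x - perp_proj \<xi> x \<in> \<xi>"
proof -
  have "x \<in> \<xi> + \<xi>\<^sup>\<bottom>"
    using subspace_sum_orthogonal_comp[OF assms] by simp
  then obtain u y where "u \<in> \<xi>" "y \<in> \<xi>\<^sup>\<bottom>" "x = u + y"
    by (meson set_plus_elim)
  then have y: "y \<in> \<xi>\<^sup>\<bottom>" "x - y \<in> \<xi>"
    by simp_all
  then have "perp_proj \<xi> x = y"
    unfolding perp_proj_def by (intro the_equality conjI) (auto intro: perp_unique[OF assms _ _ y])
  then show "perp_proj \<xi> x \<in> \<xi>\<^sup>\<bottom>" "x - perp_proj \<xi> x \<in> \<xi>"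
    using y by simp_all
qed

lemma cylinder_direction_mono:
  fixes K \<xi> K' \<xi>' :: "'a::euclidean_space set"
  assumes K: "K \<noteq> {}" and \<xi>: "subspace \<xi>"
    and K': "bounded K'" and \<xi>': "subspace \<xi>'"
    and eq: "K + \<xi> = K' + \<xi>'"
  shows "\<xi> \<subseteq> \<xi>'"
proof
  fix v assume v: "v \<in> \<xi>"
  obtain a where a: "a \<in> K" using K by auto
  obtain b where b: "\<And>x. x \<in> K' \<Longrightarrow> norm x \<le> b"
    using K' by (auto simp: bounded_iff)
  define w where "w = perp_proj \<xi>' v"
  have w: "w \<in> \<xi>'\<^sup>\<bottom>" "v - w \<in> \<xi>'"
    using perp_proj[OF \<xi>'] by (auto simp: w_def)
  have "orthogonal (v - w) w"
    using w unfolding orthogonal_comp_def by blast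
  then have vw: "v \<bullet> w = w \<bullet> w"
    by (simp add: orthogonal_def inner_diff_left)
  have bd: "a \<bullet> w + t * (w \<bullet> w) \<le> b * norm w" for t
  proof -
    have "a + t *\<^sub>R v \<in> K' + \<xi>'"
      using a v \<xi> by (subst eq[symmetric]) (intro set_plus_intro subspace_scale)
    then obtain x u where x: "x \<in> K'" "u \<in> \<xi>'" "a + t *\<^sub>R v = x + u"
      by (meson set_plus_elim)
    have "u \<bullet> w = 0"
      using w x by (auto simp: orthogonal_comp_def orthogonal_def)
    then have "a \<bullet> w + t * (w \<bullet> w) = x \<bullet> w"
      using arg_cong[OF x(3), of "\<lambda>z. z \<bullet> w"] vw by (simp add: inner_add_left)
    also have "\<dots> \<le> norm x * norm w"
      by (rule norm_cauchy_schwarz)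
    also have "\<dots> \<le> b * norm w"
      using b x by (intro mult_right_mono) auto
    finally show ?thesis .
  qed
  have "w = 0"
  proof (rule ccontr)
    assume "w \<noteq> 0"
    then have "w \<bullet> w > 0" by simp
    then show False
      using bd[of "(b * norm w - a \<bullet> w + 1) / (w \<bullet> w)"] by simp
  qed
  with w show "v \<in> \<xi>'" by simp
qed

lemma direction_cylinder:
  assumes "subspace \<xi>" "K \<in> convex_ring" "K \<subseteq> \<xi>\<^sup>\<bottom>"
  shows "direction (K + \<xi>) = \<xi>"
  unfolding direction_def
proof (rule the_equality)
  show "subspace \<xi> \<and> (\<exists>K'\<in>convex_ring. K' \<subseteq> \<xi>\<^sup>\<bottom> \<and> K + \<xi> = K' + \<xi>)"
    using assms by blast
next
  fix \<xi>' assume "subspace \<xi>' \<and> (\<exists>K'\<in>convex_ring. K' \<subseteq> \<xi>'\<^sup>\<bottom> \<and> K + \<xi> = K' + \<xi>')"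
  then obtain K' where *: "subspace \<xi>'" "K' \<in> convex_ring" "K + \<xi> = K' + \<xi>'" by blast
  have "K \<noteq> {}" "bounded K" "K' \<noteq> {}" "bounded K'"
    using assms(2) *(2) by (simp_all add: convex_ring_nonempty compact_imp_bounded convex_ring_compact)
  then show "\<xi>' = \<xi>"
    using cylinder_direction_mono[OF _ assms(1) _ *(1) *(3)]
      cylinder_direction_mono[OF _ *(1) _ assms(1) *(3)[symmetric]] by (intro equalityI)
qed

lemma cross_section_cylinder:
  assumes "subspace \<xi>" "K \<in> convex_ring" "K \<subseteq> \<xi>\<^sup>\<bottom>"
  shows "cross_section (K + \<xi>) = K"
proof -
  have "(K + \<xi>) \<inter> \<xi>\<^sup>\<bottom> = K"
  proof
    show "(K + \<xi>) \<inter> \<xi>\<^sup>\<bottom> \<subseteq> K"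
    proof
      fix z assume z: "z \<in> (K + \<xi>) \<inter> \<xi>\<^sup>\<bottom>"
      then obtain x u where xu: "x \<in> K" "u \<in> \<xi>" "z = x + u"
        by (auto elim: set_plus_elim)
      have "z = x"
        using z xu assms subspace_0[OF assms(1)] by (intro perp_unique[of \<xi> z z x]) auto
      with xu show "z \<in> K" by simp
    qed
    show "K \<subseteq> (K + \<xi>) \<inter> \<xi>\<^sup>\<bottom>"
      using assms subspace_0[OF assms(1)] by (force simp: set_plus_def)
  qed
  then show ?thesis
    by (simp add: cross_section_def direction_cylinder[OF assms])
qed

lemma infdist_bdd_above:
  fixes K L :: "'a::euclidean_space set"
  assumes "bounded K"
  shows "bdd_above ((\<lambda>x. infdist x L) ` K)"
proof -
  obtain b where "\<And>x. x \<in> K \<Longrightarrow> norm x \<le> b"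
    using assms by (auto simp: bounded_iff)
  moreover have "infdist x L \<le> infdist 0 L + norm x" for x
    using infdist_triangle[of x L 0] by simp
  ultimately show ?thesis
    by (intro bdd_aboveI[of _ "infdist 0 L + b"]) (force intro: order_trans)
qed

lemma infdist_le_hausdorff_dist:
  fixes K L :: "'a::euclidean_space set"
  assumes "bounded K" "bounded L" "L \<noteq> {}" "x \<in> K"
  shows "infdist x L \<le> hausdorff_dist K L"
proof -
  have "infdist x L \<le> (SUP x\<in>K. infdist x L)"
    using assms by (intro cSUP_upper infdist_bdd_above)
  with assms show ?thesis by (auto simp: hausdorff_dist_def)
qed

lemma hausdorff_dist_commute: "hausdorff_dist K L = hausdorff_dist L K"
  by (auto simp: hausdorff_dist_def max.commute)

lemma hausdorff_dist_nonneg: "0 \<le> hausdorff_dist K L"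
proof (cases "K \<noteq> {} \<and> bounded K \<and> L \<noteq> {} \<and> bounded L")
  case True
  then obtain x where "x \<in> K" by auto
  then show ?thesis
    using True infdist_le_hausdorff_dist[of K L x] infdist_nonneg[of x L] by linarith
qed (auto simp: hausdorff_dist_def)

lemma infdist_hausdorff_triangle:
  fixes K L J :: "'a::euclidean_space set"
  assumes "bounded K" "compact L" "L \<noteq> {}" "bounded J" "J \<noteq> {}" "x \<in> K"
  shows "infdist x J \<le> hausdorff_dist K L + hausdorff_dist L J"
proof -
  obtain y where y: "y \<in> L" "infdist x L = dist x y"
    using infdist_attains_inf[of L x] assms compact_imp_closed by blast
  have "infdist x J \<le> infdist y J + dist x y"
    by (rule infdist_triangle)
  also have "\<dots> \<le> hausdorff_dist L J + hausdorff_dist K L"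
    unfolding y(2)[symmetric] using y(1) assms compact_imp_bounded[of L]
    by (intro add_mono infdist_le_hausdorff_dist) auto
  finally show ?thesis by simp
qed

lemma Metric_space_hausdorff:
  fixes \<K> :: "'a::euclidean_space set set"
  assumes "\<And>K. K \<in> \<K> \<Longrightarrow> compact K \<and> K \<noteq> {}"
  shows "Metric_space \<K> hausdorff_dist"
proof
  fix K L :: "'a set" assume K: "K \<in> \<K>" and L: "L \<in> \<K>"
  then have c: "compact K" "K \<noteq> {}" "bounded K" "compact L" "L \<noteq> {}" "bounded L"
    using assms compact_imp_bounded by auto
  show "hausdorff_dist K L = 0 \<longleftrightarrow> K = L"
  proof
    assume 0: "hausdorff_dist K L = 0"
    have "infdist x L = 0" if "x \<in> K" for x
      using infdist_le_hausdorff_dist[of K L x] infdist_nonneg[of x L] that c 0 by auto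
    moreover have "infdist x K = 0" if "x \<in> L" for x
      using infdist_le_hausdorff_dist[of L K x] infdist_nonneg[of x K] that c 0
      by (auto simp: hausdorff_dist_commute[of L K])
    ultimately show "K = L"
      using c in_closed_iff_infdist_zero compact_imp_closed by blast
  next
    assume "K = L"
    then show "hausdorff_dist K L = 0"
      using c by (simp add: hausdorff_dist_def)
  qed
next
  fix K L J :: "'a set" assume "K \<in> \<K>" "L \<in> \<K>" "J \<in> \<K>"
  then have c: "compact K" "K \<noteq> {}" "bounded K" "compact L" "L \<noteq> {}" "bounded L"
    "compact J" "J \<noteq> {}" "bounded J"
    using assms compact_imp_bounded by auto
  have "(SUP x\<in>K. infdist x J) \<le> hausdorff_dist K L + hausdorff_dist L J"
    using c by (intro cSUP_least infdist_hausdorff_triangle)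
  moreover have "(SUP x\<in>J. infdist x K) \<le> hausdorff_dist J L + hausdorff_dist L K"
    using c by (intro cSUP_least infdist_hausdorff_triangle)
  ultimately show "hausdorff_dist K J \<le> hausdorff_dist K L + hausdorff_dist L J"
    using c by (simp add: hausdorff_dist_def[of K J] hausdorff_dist_commute[of J L]
        hausdorff_dist_commute[of L K])
qed (auto simp: hausdorff_dist_nonneg hausdorff_dist_commute)

lemma Metric_space_convex_ring: "Metric_space convex_ring hausdorff_dist"
  by (intro Metric_space_hausdorff) (auto simp: convex_ring_compact convex_ring_nonempty)

lemma Metric_space_grassmannian: "Metric_space (grassmannian k) grassmannian_dist"
proof -
  let ?b = "\<lambda>\<xi>::'a set. \<xi> \<inter> cball 0 1"
  have "compact (?b \<xi>) \<and> ?b \<xi> \<noteq> {}" if "\<xi> \<in> grassmannian k" for \<xi>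
    using that subspace_0[of \<xi>] by (auto simp: grassmannian_def closed_Int_compact closed_subspace)
  then interpret Metric_space "?b ` grassmannian k" hausdorff_dist
    by (intro Metric_space_hausdorff) auto
  have sub: "\<xi> \<subseteq> \<eta>" if "subspace \<xi>" "subspace \<eta>" "?b \<xi> = ?b \<eta>" for \<xi> \<eta>
  proof
    fix v assume v: "v \<in> \<xi>"
    have "(1 / norm v) *\<^sub>R v \<in> ?b \<eta>"
      using v that(1) by (subst that(3)[symmetric]) (auto simp: subspace_scale)
    then have "norm v *\<^sub>R ((1 / norm v) *\<^sub>R v) \<in> \<eta>"
      by (elim IntE) (rule subspace_scale[OF that(2)])
    then show "v \<in> \<eta>"
      using subspace_0[OF that(2)] by (cases "v = 0") auto
  qed
  show ?thesis
  proof
    fix \<xi> \<eta> :: "'a set" assume "\<xi> \<in> grassmannian k" "\<eta> \<in> grassmannian k"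
    then show "grassmannian_dist \<xi> \<eta> = 0 \<longleftrightarrow> \<xi> = \<eta>"
      using zero[of "?b \<xi>" "?b \<eta>"] sub[of \<xi> \<eta>] sub[of \<eta> \<xi>]
      by (auto simp: grassmannian_dist_def grassmannian_def)
  next
    fix \<xi> \<eta> \<zeta> :: "'a set"
    assume "\<xi> \<in> grassmannian k" "\<eta> \<in> grassmannian k" "\<zeta> \<in> grassmannian k"
    then show "grassmannian_dist \<xi> \<zeta> \<le> grassmannian_dist \<xi> \<eta> + grassmannian_dist \<eta> \<zeta>"
      unfolding grassmannian_dist_def by (intro triangle imageI)
  qed (simp_all add: grassmannian_dist_def commute)
qed

end

theory Submission
  imports Defs
begin

text \<open>The union set meets \<open>B\<close> exactly when the process has a point in the set \<open>A\<close> of all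
  cylinders hitting \<open>B\<close>, so \<open>1 - T(B)\<close> is the void probability of \<open>A\<close>. The mass \<open>\<Lambda> A\<close> is finite by
  local finiteness, hence the void probability is \<open>exp (- \<Lambda> A)\<close>. It remains to compute
  \<open>\<Lambda> A\<close> by disintegrating \<open>\<Lambda>\<close> into translations and shapes: for a cylinder \<open>Z\<close> with direction \<open>\<xi>\<close>
  and cross-section \<open>K\<close>, the translate \<open>x + Z\<close> by some \<open>x \<in> \<xi>\<^sup>\<bottom>\<close> hits \<open>B\<close> iff
  \<open>x + y = \<pi> b\<close> for some \<open>y \<in> K\<close> and \<open>b \<in> B\<close>, where \<open>\<pi>\<close> projects along \<open>\<xi>\<close>; that is, iff
  \<open>x\<close> lies in the Minkowski sum of \<open>-K\<close> and \<open>\<pi> B\<close>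
  (\<open>translate_hits_iff\<close>).

  Two measurability facts support this. First, \<open>A\<close> is measurable, because hitting a compact set is a
  closed condition on the pair of direction and cross-section (\<open>closedin_hitting_pairs\<close>). Second,
  singletons are measurable, so that the points of a realisation are all recorded by its support
  (\<open>support_meets_iff\<close>).\<close>

section \<open>Cylinders and their translates\<close>

lemma cylindersE:
  fixes Z :: "'a::euclidean_space set"
  assumes "Z \<in> cylinders k"
  obtains "direction Z \<in> grassmannian k" "subspace (direction Z)" "cross_section Z \<in> convex_ring"
    "cross_section Z \<subseteq> (direction Z)\<^sup>\<bottom>" "cross_section Z + direction Z = Z"
proof -
  obtain K \<xi> where *: "\<xi> \<in> grassmannian k" "subspace \<xi>" "K \<in> convex_ring" "K \<subseteq> \<xi>\<^sup>\<bottom>" "Z = K + \<xi>"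
    using assms by (auto simp: cylinders_def grassmannian_def)
  show thesis
    by (rule that) (use * direction_cylinder[of \<xi> K] cross_section_cylinder[of \<xi> K] in simp_all)
qed

lemma convex_ring_translation:
  fixes K :: "'a::euclidean_space set"
  assumes "K \<in> convex_ring"
  shows "(+) x ` K \<in> convex_ring"
proof -
  obtain F where F: "K = \<Union>F" "finite F" "F \<noteq> {}" "\<forall>C\<in>F. C \<noteq> {} \<and> compact C \<and> convex C"
    using assms by (auto simp: convex_ring_def)
  show ?thesis
    unfolding convex_ring_def using F
    by (intro CollectI exI[of _ "image ((+) x) ` F"]) (auto simp: compact_translation convex_translation)
qed

lemma cylinders_translation:
  fixes Z :: "'a::euclidean_space set"
  assumes Z: "Z \<in> cylinders k" and x: "x \<in> (direction Z)\<^sup>\<bottom>"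
  shows "(+) x ` Z \<in> cylinders k"
proof (rule cylindersE[OF Z])
  assume *: "direction Z \<in> grassmannian k" "cross_section Z \<in> convex_ring"
    "cross_section Z \<subseteq> (direction Z)\<^sup>\<bottom>" "cross_section Z + direction Z = Z"
  have translate: "(+) x ` A = {x} + A" for A
    by (auto simp: set_plus_def)
  have "(+) x ` Z = {x} + (cross_section Z + direction Z)"
    using *(4) translate[of Z] by simp
  also have "\<dots> = (+) x ` cross_section Z + direction Z"
    unfolding translate[of "cross_section Z"] by (rule add.assoc[symmetric])
  finally have "(+) x ` Z = (+) x ` cross_section Z + direction Z" .
  moreover have "(+) x ` cross_section Z \<subseteq> (direction Z)\<^sup>\<bottom>"
    using *(3) subspace_add[OF subspace_orthogonal_comp x] by blast
  ultimately show ?thesis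
    unfolding cylinders_def using *(1) convex_ring_translation[OF *(2), of x]
    by (intro CollectI exI conjI)
qed

lemma perp_proj_eqI:
  fixes \<xi> :: "'a::euclidean_space set"
  assumes "subspace \<xi>" "y \<in> \<xi>\<^sup>\<bottom>" "x - y \<in> \<xi>"
  shows "perp_proj \<xi> x = y"
  using perp_unique[OF assms(1) perp_proj[OF assms(1)] assms(2,3)] .

lemma linear_perp_proj:
  fixes \<xi> :: "'a::euclidean_space set"
  assumes "subspace \<xi>"
  shows "linear (perp_proj \<xi>)"
proof (rule linearI)
  note p = perp_proj[OF assms] and perp = subspace_orthogonal_comp[of \<xi>]
  show "perp_proj \<xi> (x + y) = perp_proj \<xi> x + perp_proj \<xi> y" for x y
    using subspace_add[OF assms p(2)[of x] p(2)[of y]]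
    by (intro perp_proj_eqI[OF assms] subspace_add[OF perp] p(1)) (simp add: algebra_simps)
  show "perp_proj \<xi> (r *\<^sub>R x) = r *\<^sub>R perp_proj \<xi> x" for r x
    using subspace_scale[OF assms p(2)[of x], of r]
    by (intro perp_proj_eqI[OF assms] subspace_scale[OF perp] p(1)) (simp add: algebra_simps)
qed

lemma translate_hits_iff:
  fixes \<xi> :: "'a::euclidean_space set"
  assumes \<xi>: "subspace \<xi>" and K: "K \<subseteq> \<xi>\<^sup>\<bottom>" and x: "x \<in> \<xi>\<^sup>\<bottom>"
  shows "(+) x ` (K + \<xi>) \<inter> B \<noteq> {} \<longleftrightarrow> x \<in> uminus ` K + perp_proj \<xi> ` B"
proof
  assume "(+) x ` (K + \<xi>) \<inter> B \<noteq> {}"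
  then obtain y u where yu: "y \<in> K" "u \<in> \<xi>" "x + (y + u) \<in> B"
    by (auto simp: set_plus_def)
  have "perp_proj \<xi> (x + (y + u)) = x + y"
    using yu K x by (intro perp_proj_eqI[OF \<xi>]) (auto intro!: subspace_add subspace_orthogonal_comp)
  then have "x = - y + perp_proj \<xi> (x + (y + u))"
    by simp
  then show "x \<in> uminus ` K + perp_proj \<xi> ` B"
    using yu by (auto simp: set_plus_def)
next
  assume "x \<in> uminus ` K + perp_proj \<xi> ` B"
  then obtain y b where yb: "y \<in> K" "b \<in> B" "x = - y + perp_proj \<xi> b"
    by (auto simp: set_plus_def)
  have "y + (b - perp_proj \<xi> b) \<in> K + \<xi>"
    using yb perp_proj(2)[OF \<xi>] by (intro set_plus_intro)
  moreover have "x + (y + (b - perp_proj \<xi> b)) = b"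
    using yb by simp
  ultimately have "b \<in> (+) x ` (K + \<xi>)"
    by (metis imageI)
  then show "(+) x ` (K + \<xi>) \<inter> B \<noteq> {}"
    using yb(2) by blast
qed

lemma compact_set_plus:
  fixes S T :: "'a::euclidean_space set"
  assumes "compact S" "compact T"
  shows "compact (S + T)"
proof -
  have "S + T = {x + y |x y. x \<in> S \<and> y \<in> T}"
    by (auto simp: set_plus_def)
  then show ?thesis
    using compact_sums[OF assms] by simp
qed

lemma space_subspace_lborel: "space (subspace_lborel V) = V"
  by (simp add: subspace_lborel_def Let_def space_restrict_space)

lemma sets_subspace_lborel: "sets (subspace_lborel V) = sets (restrict_space borel V)"
  by (simp add: subspace_lborel_def Let_def)

section \<open>Measurability of hitting a compact set\<close>

lemma hausdorff_dist_lessD: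
  fixes K K' :: "'a::euclidean_space set"
  assumes "compact K" "K \<noteq> {}" "bounded K'" "hausdorff_dist K K' < e" "x' \<in> K'"
  shows "\<exists>x\<in>K. dist x' x < e"
proof -
  obtain x where "x \<in> K" "infdist x' K = dist x' x"
    using infdist_attains_inf[of K x'] assms compact_imp_closed by blast
  moreover have "infdist x' K \<le> hausdorff_dist K' K"
    using assms compact_imp_bounded by (intro infdist_le_hausdorff_dist) auto
  ultimately show ?thesis
    using assms(4) hausdorff_dist_commute[of K K'] by (intro bexI[of _ x]) auto
qed

text \<open>A point of the perturbed cylinder in \<open>B\<close> has both its components bounded in terms of \<open>B\<close> and \<open>K\<close>
  alone; on a bounded region nearby directions stay uniformly close, so such a point would lie
  close to the original cylinder, which has positive distance from \<open>B\<close>.\<close>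

lemma nearby_cylinders_disjoint:
  fixes K \<xi> B :: "'a::euclidean_space set"
  assumes \<xi>: "subspace \<xi>" and K: "compact K" "K \<noteq> {}" and B: "compact B"
    and disj: "(K + \<xi>) \<inter> B = {}"
  obtains e where "e > 0"
    "\<And>\<xi>' K'. \<lbrakk>subspace \<xi>'; bounded K'; grassmannian_dist \<xi> \<xi>' < e; hausdorff_dist K K' < e\<rbrakk>
      \<Longrightarrow> (K' + \<xi>') \<inter> B = {}"
proof -
  have "K + \<xi> = (\<Union>x\<in>K. \<Union>y\<in>\<xi>. {x + y})"
    by (auto simp: set_plus_def)
  then have "closed (K + \<xi>)"
    using compact_closed_sums[OF K(1) closed_subspace[OF \<xi>]] by simp
  then obtain d where d: "d > 0" "\<And>b z. b \<in> B \<Longrightarrow> z \<in> K + \<xi> \<Longrightarrow> d \<le> dist b z"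
    using separate_compact_closed[OF B] disj by (metis Int_commute)
  obtain R where R: "R > 0" "\<And>x. x \<in> K \<union> B \<Longrightarrow> norm x \<le> R"
    using bounded_pos[of "K \<union> B"] compact_imp_bounded[OF K(1)] compact_imp_bounded[OF B] by auto
  define s where "s = 2 * R + 1"
  \<comment> \<open>\<open>s\<close> bounds the component of a common point in the perturbed direction; \<open>s + 1\<close> adds the
    error of the other component.\<close>
  define e where "e = min 1 (d / (s + 1))"
  have s: "s > 0" using R by (simp add: s_def)
  have e: "e > 0" "e \<le> 1" "e * (s + 1) \<le> d"
  proof -
    show "e > 0" "e \<le> 1" using s d by (simp_all add: e_def)
    have "e \<le> d / (s + 1)" by (simp add: e_def)
    then show "e * (s + 1) \<le> d" using s by (simp add: pos_le_divide_eq)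
  qed
  show thesis
  proof (rule that[OF e(1)])
    fix \<xi>' K' :: "'a set"
    assume \<xi>': "subspace \<xi>'" and K': "bounded K'"
      and dist: "grassmannian_dist \<xi> \<xi>' < e" "hausdorff_dist K K' < e"
    show "(K' + \<xi>') \<inter> B = {}"
    proof (rule ccontr)
      assume "(K' + \<xi>') \<inter> B \<noteq> {}"
      then obtain x' u' where b: "x' \<in> K'" "u' \<in> \<xi>'" "x' + u' \<in> B"
        by (auto simp: set_plus_def)
      obtain x where x: "x \<in> K" "dist x' x < e"
        using hausdorff_dist_lessD[OF K K' dist(2) b(1)] by blast
      have "norm x' \<le> norm x + dist x' x"
        using norm_triangle_ineq[of x "x' - x"] by (simp add: dist_norm)
      moreover have "norm u' \<le> norm (x' + u') + norm x'"
        using norm_triangle_ineq4[of "x' + u'" x'] by simp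
      moreover have "norm x \<le> R" "norm (x' + u') \<le> R"
        using R(2) x(1) b(3) by auto
      ultimately have u': "norm u' \<le> s"
        using x(2) e(2) by (simp add: s_def)
      \<comment> \<open>the distance of directions compares unit balls only, whence the rescaling by \<open>s\<close>\<close>
      have "(1 / s) *\<^sub>R u' \<in> \<xi>' \<inter> cball 0 1"
        using u' s subspace_scale[OF \<xi>' b(2)] by simp
      moreover have "compact (\<xi> \<inter> cball 0 1)" "\<xi> \<inter> cball 0 1 \<noteq> {}"
        using subspace_0[OF \<xi>] by (auto simp: closed_Int_compact closed_subspace[OF \<xi>])
      ultimately obtain v where v: "v \<in> \<xi>" "dist ((1 / s) *\<^sub>R u') v < e"
        using hausdorff_dist_lessD[of "\<xi> \<inter> cball 0 1" "\<xi>' \<inter> cball 0 1" e] dist(1)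
        unfolding grassmannian_dist_def by blast
      have "dist u' (s *\<^sub>R v) = s * dist ((1 / s) *\<^sub>R u') v"
      proof -
        have "u' - s *\<^sub>R v = s *\<^sub>R ((1 / s) *\<^sub>R u' - v)"
          using s by (simp add: algebra_simps)
        then show ?thesis
          using s by (simp add: dist_norm)
      qed
      also have "\<dots> < s * e"
        using v(2) s by simp
      finally have "dist u' (s *\<^sub>R v) < s * e" .
      moreover have "dist (x' + u') (x + s *\<^sub>R v) \<le> dist x' x + dist u' (s *\<^sub>R v)"
        by (rule dist_triangle_add)
      moreover have "d \<le> dist (x' + u') (x + s *\<^sub>R v)"
        using b(3) x(1) v(1) by (intro d(2) set_plus_intro subspace_scale[OF \<xi>])
      ultimately show False
        using x(2) e(3) by (simp add: algebra_simps)
    qed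
  qed
qed

abbreviation cylinder_topology :: "nat \<Rightarrow> ('a::euclidean_space set \<times> 'a set) topology" where
  "cylinder_topology k \<equiv>
    prod_topology (Metric_space.mtopology (grassmannian k) grassmannian_dist)
      (Metric_space.mtopology convex_ring hausdorff_dist)"

lemma topspace_cylinder_topology:
  "topspace (cylinder_topology k) = grassmannian k \<times> convex_ring"
  by (simp add: Metric_space.topspace_mtopology Metric_space_grassmannian Metric_space_convex_ring)

lemma closedin_hitting_pairs:
  fixes B :: "'a::euclidean_space set"
  assumes B: "compact B"
  shows "closedin (cylinder_topology k)
    {(\<xi>, K). \<xi> \<in> grassmannian k \<and> K \<in> convex_ring \<and> (K + \<xi>) \<inter> B \<noteq> {}}" (is "closedin _ ?H")
proof -
  interpret G: Metric_space "grassmannian k :: 'a set set" grassmannian_dist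
    by (rule Metric_space_grassmannian)
  interpret C: Metric_space "convex_ring :: 'a set set" hausdorff_dist
    by (rule Metric_space_convex_ring)
  have "\<exists>U V. openin G.mtopology U \<and> openin C.mtopology V \<and> \<xi> \<in> U \<and> K \<in> V \<and>
      U \<times> V \<subseteq> grassmannian k \<times> convex_ring - ?H"
    if \<xi>K: "(\<xi>, K) \<in> grassmannian k \<times> convex_ring - ?H" for \<xi> K
  proof -
    have sub: "subspace \<xi>" and K: "compact K" "K \<noteq> {}" and disj: "(K + \<xi>) \<inter> B = {}"
      using \<xi>K by (auto simp: grassmannian_def convex_ring_compact convex_ring_nonempty)
    from nearby_cylinders_disjoint[OF sub K B disj]
    obtain e where e: "e > 0"
      "\<And>\<xi>' K'. \<lbrakk>subspace \<xi>'; bounded K'; grassmannian_dist \<xi> \<xi>' < e; hausdorff_dist K K' < e\<rbrakk>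
        \<Longrightarrow> (K' + \<xi>') \<inter> B = {}"
      by blast
    have "G.mball \<xi> e \<times> C.mball K e \<subseteq> grassmannian k \<times> convex_ring - ?H"
    proof -
      have "(K' + \<xi>') \<inter> B = {}" if "\<xi>' \<in> grassmannian k" "grassmannian_dist \<xi> \<xi>' < e"
        "K' \<in> convex_ring" "hausdorff_dist K K' < e" for \<xi>' K'
        using that by (intro e(2)) (auto simp: grassmannian_def convex_ring_compact compact_imp_bounded)
      then show ?thesis by fastforce
    qed
    then show ?thesis
      using e(1) \<xi>K by (intro exI[of _ "G.mball \<xi> e"] exI[of _ "C.mball K e"]) auto
  qed
  then have "openin (cylinder_topology k) (grassmannian k \<times> convex_ring - ?H)"
    unfolding openin_prod_topology_alt by blast
  then show ?thesis
    unfolding closedin_def topspace_cylinder_topology by auto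
qed

lemma space_cylinder_algebra: "space (cylinder_algebra k) = cylinders k"
  by (simp add: cylinder_algebra_def)

lemma closed_sets_borel_of_topology:
  assumes "closedin X S"
  shows "S \<in> sets (borel_of_topology X)"
proof -
  let ?S = "sigma (topspace X) {U. openin X U}"
  have sub: "{U. openin X U} \<subseteq> Pow (topspace X)"
    using openin_subset by auto
  have "topspace X - S \<in> sets ?S"
    using assms by (intro in_measure_of sub) auto
  then have "space ?S - (topspace X - S) \<in> sets ?S"
    by (rule sets.compl_sets)
  then show ?thesis
    using closedin_subset[OF assms]
    by (simp add: borel_of_topology_def space_measure_of[OF sub] double_diff)
qed

lemma cylinder_algebra_closedI:
  assumes "closedin (cylinder_topology k) S"
  shows "{Z \<in> cylinders k. (direction Z, cross_section Z) \<in> S} \<in> sets (cylinder_algebra k)"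
proof -
  have "(\<lambda>Z. (direction Z, cross_section Z)) -` S \<inter> cylinders k \<in> sets (cylinder_algebra k)"
    unfolding cylinder_algebra_def
    by (intro in_vimage_algebra closed_sets_borel_of_topology assms)
  then show ?thesis
    by (simp add: vimage_def Int_def conj_commute)
qed

lemma hitting_cylinders_measurable:
  fixes B :: "'a::euclidean_space set"
  assumes "compact B"
  shows "{Z \<in> cylinders k. Z \<inter> B \<noteq> {}} \<in> sets (cylinder_algebra k)"
proof -
  let ?H = "{(\<xi>, K). \<xi> \<in> grassmannian k \<and> K \<in> convex_ring \<and> (K + \<xi>) \<inter> B \<noteq> {}}"
  have "Z \<inter> B \<noteq> {} \<longleftrightarrow> (direction Z, cross_section Z) \<in> ?H" if "Z \<in> cylinders k" for Z
    using that by (rule cylindersE) simp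
  then have "{Z \<in> cylinders k. Z \<inter> B \<noteq> {}} =
      {Z \<in> cylinders k. (direction Z, cross_section Z) \<in> ?H}"
    by blast
  then show ?thesis
    using cylinder_algebra_closedI[OF closedin_hitting_pairs[OF assms]] by simp
qed

text \<open>Direction and cross-section determine the cylinder, so that a singleton of cylinders is
  the preimage of a singleton, which is closed in the Hausdorff product topology.\<close>

lemma singleton_cylinder_measurable:
  fixes Z :: "'a::euclidean_space set"
  assumes Z: "Z \<in> cylinders k"
  shows "{Z} \<in> sets (cylinder_algebra k)"
proof -
  have "(direction Z, cross_section Z) \<in> topspace (cylinder_topology k)"
    unfolding topspace_cylinder_topology by (rule cylindersE[OF Z]) (rule SigmaI)
  moreover have "Hausdorff_space (cylinder_topology k :: ('a set \<times> 'a set) topology)"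
    by (simp add: Hausdorff_space_prod_topology Metric_space.Hausdorff_space_mtopology
        Metric_space_grassmannian Metric_space_convex_ring)
  ultimately have "closedin (cylinder_topology k) {(direction Z, cross_section Z)}"
    by (simp add: closedin_Hausdorff_singleton)
  note cylinder_algebra_closedI[OF this]
  moreover have "{Z} = {Z' \<in> cylinders k. (direction Z', cross_section Z') \<in>
      {(direction Z, cross_section Z)}}"
  proof -
    have "Z' = Z" if Z': "Z' \<in> cylinders k"
      and eq: "direction Z' = direction Z" "cross_section Z' = cross_section Z" for Z'
    proof -
      have "Z' = cross_section Z' + direction Z'" using Z' by (rule cylindersE) (rule sym)
      also have "\<dots> = cross_section Z + direction Z" using eq by simp
      also have "\<dots> = Z" using Z by (rule cylindersE)
      finally show ?thesis .
    qed
    then show ?thesis using Z by blast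
  qed
  ultimately show ?thesis
    by (simp only:)
qed

section \<open>Realisations as counting measures\<close>

lemma space_counting_algebra: "space (counting_algebra S) = counting_measures S"
proof -
  have "space (counting_algebra S) =
      (\<Union>A\<in>sets S. space (vimage_algebra (counting_measures S) (\<lambda>N. emeasure N A) borel))"
    unfolding counting_algebra_def by (simp add: space_Sup_eq_UN)
  then show ?thesis by auto
qed

lemma measurable_emeasure_counting_algebra:
  assumes "A \<in> sets S"
  shows "(\<lambda>N. emeasure N A) \<in> borel_measurable (counting_algebra S)"
  unfolding counting_algebra_def
  by (rule measurable_Sup1[OF imageI[OF assms] measurable_vimage_algebra1]) auto

text \<open>Points of a counting measure are atoms of it only because singletons are measurable:
  otherwise the measure of a singleton would be the default value 0.\<close>

lemma support_meets_iff:
  assumes N: "N \<in> counting_measures S" and A: "A \<in> sets S"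
    and single: "\<And>z. z \<in> space S \<Longrightarrow> {z} \<in> sets S"
  shows "support N \<inter> A \<noteq> {} \<longleftrightarrow> emeasure N A \<noteq> 0"
proof -
  obtain I :: "nat set" and z where z: "N = distr (count_space I) S z" "z \<in> I \<rightarrow> space S"
    using N by (auto simp: counting_measures_def)
  have pos: "emeasure N E \<noteq> 0 \<longleftrightarrow> (\<exists>i\<in>I. z i \<in> E)" if "E \<in> sets S" for E
  proof -
    have "emeasure N E = emeasure (count_space I) (z -` E \<inter> I)"
      unfolding z(1) using that z(2) by (subst emeasure_distr) auto
    then show ?thesis
      by (auto simp: emeasure_count_space_eq_0)
  qed
  have "support N = z ` I"
    using pos single z by (force simp: support_def zero_less_iff_neq_zero)
  then show ?thesis
    using pos[OF A] by auto
qed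

lemma void_probability:
  assumes pp: "poisson_process M \<Lambda> \<Xi>" and A: "A \<in> sets \<Lambda>" and fin: "emeasure \<Lambda> A \<noteq> \<infinity>"
  shows "measure M {\<omega> \<in> space M. emeasure (\<Xi> \<omega>) A = 0} = exp (- measure \<Lambda> A)"
proof -
  have "if emeasure \<Lambda> A = \<infinity> then AE \<omega> in M. emeasure (\<Xi> \<omega>) A = \<infinity>
      else \<forall>n::nat. measure M {\<omega> \<in> space M. emeasure (\<Xi> \<omega>) A = of_nat n} =
             measure \<Lambda> A ^ n / fact n * exp (- measure \<Lambda> A)"
    using pp A unfolding poisson_process_def by blast
  then have "measure M {\<omega> \<in> space M. emeasure (\<Xi> \<omega>) A = of_nat n} =
      measure \<Lambda> A ^ n / fact n * exp (- measure \<Lambda> A)" for n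
    unfolding if_not_P[OF fin] by (rule spec)
  from this[of 0] show ?thesis
    by simp
qed

section \<open>The capacity functional\<close>

text \<open>The disintegration of \<open>\<Lambda>\<close> applied to the indicator of the hitting set: its inner integrand is
  the indicator of a Minkowski sum, which is measurable in \<open>(direction Z)\<^sup>\<bottom>\<close> as a compact subset of
  it.\<close>

lemma intensity_hitting_cylinders:
  fixes B :: "'a::euclidean_space set"
  assumes sets: "sets \<Lambda> = sets (cylinder_algebra k)" and shape: "intensity_and_shape k \<Lambda> l \<theta>"
    and B: "compact B"
  shows "emeasure \<Lambda> {Z \<in> cylinders k. Z \<inter> B \<noteq> {}} =
    ennreal l * (\<integral>\<^sup>+Z. emeasure (subspace_lborel ((direction Z)\<^sup>\<bottom>))
      (uminus ` cross_section Z + perp_proj (direction Z) ` B) \<partial>\<theta>)"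
proof -
  let ?A = "{Z \<in> cylinders k. Z \<inter> B \<noteq> {}}"
  have A: "?A \<in> sets (cylinder_algebra k)"
    by (rule hitting_cylinders_measurable[OF B])
  have "space \<theta> = cylinders k \<inter> centred_cylinders k"
    using shape sets_eq_imp_space_eq[of \<theta>]
    by (force simp: intensity_and_shape_def space_restrict_space space_cylinder_algebra)
  then have space_\<theta>: "Z \<in> cylinders k" if "Z \<in> space \<theta>" for Z
    using that by auto
  have inner: "(\<integral>\<^sup>+x. indicator ?A ((+) x ` Z) \<partial>subspace_lborel ((direction Z)\<^sup>\<bottom>)) =
      emeasure (subspace_lborel ((direction Z)\<^sup>\<bottom>))
        (uminus ` cross_section Z + perp_proj (direction Z) ` B)"
    if Z: "Z \<in> cylinders k" for Z
  proof (rule cylindersE[OF Z])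
    let ?V = "(direction Z)\<^sup>\<bottom>"
    let ?D = "uminus ` cross_section Z + perp_proj (direction Z) ` B"
    assume *: "subspace (direction Z)" "cross_section Z \<in> convex_ring" "cross_section Z \<subseteq> ?V"
      "cross_section Z + direction Z = Z"
    have "?D \<subseteq> ?V"
      using *(3) perp_proj(1)[OF *(1)]
      by (auto elim!: set_plus_elim
          intro!: subspace_diff[OF subspace_orthogonal_comp])
    moreover have "compact ?D"
      using *(2) B linear_perp_proj[OF *(1)]
      by (intro compact_set_plus compact_negations compact_continuous_image
          linear_continuous_on linear_linear[THEN iffD2] convex_ring_compact[of "cross_section Z"])
    ultimately have D: "?D \<in> sets (subspace_lborel ?V)"
      unfolding sets_subspace_lborel sets_restrict_space
      by (intro image_eqI[of _ _ ?D]) (auto simp: borel_compact)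
    have "(\<integral>\<^sup>+x. indicator ?A ((+) x ` Z) \<partial>subspace_lborel ?V) =
        (\<integral>\<^sup>+x. indicator ?D x \<partial>subspace_lborel ?V)"
    proof (rule nn_integral_cong)
      fix x assume "x \<in> space (subspace_lborel ?V)"
      then have x: "x \<in> ?V" by (simp add: space_subspace_lborel)
      have "(+) x ` Z \<inter> B \<noteq> {} \<longleftrightarrow> x \<in> ?D"
        using translate_hits_iff[OF *(1,3) x, of B] *(4) by simp
      then show "(indicator ?A ((+) x ` Z) :: ennreal) = indicator ?D x"
        using cylinders_translation[OF Z x] by (simp add: indicator_def)
    qed
    also have "\<dots> = emeasure (subspace_lborel ?V) ?D"
      using D by (rule nn_integral_indicator)
    finally show ?thesis .
  qed
  have "emeasure \<Lambda> ?A = (\<integral>\<^sup>+Z. indicator ?A Z \<partial>\<Lambda>)"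
    using A sets by (intro nn_integral_indicator[symmetric]) simp
  also have "\<dots> = ennreal l *
      (\<integral>\<^sup>+Z. (\<integral>\<^sup>+x. indicator ?A ((+) x ` Z) \<partial>subspace_lborel ((direction Z)\<^sup>\<bottom>)) \<partial>\<theta>)"
    using shape borel_measurable_indicator[OF A] unfolding intensity_and_shape_def by blast
  also have "\<dots> = ennreal l * (\<integral>\<^sup>+Z. emeasure (subspace_lborel ((direction Z)\<^sup>\<bottom>))
      (uminus ` cross_section Z + perp_proj (direction Z) ` B) \<partial>\<theta>)"
    by (intro arg_cong2[of _ _ _ _ "(*)"] nn_integral_cong inner space_\<theta> refl)
  finally show ?thesis .
qed

theorem lemma1:
  fixes M :: "'w measure"
    and \<Xi> :: "'w \<Rightarrow> 'a::euclidean_space set measure"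
    and \<Lambda> \<theta> :: "'a set measure"
    and k :: nat and l :: real and B :: "'a set"
  assumes "k < DIM('a)"
    and "poisson_cylinder_process M k \<Lambda> \<Xi>"
    and "simple_process M \<Xi>"
    and "stationary M k \<Xi>"
    and "intensity_and_shape k \<Lambda> l \<theta>"
    and "compact B" and "B \<noteq> {}"
  shows "capacity_functional M (union_set \<Xi>) B =
    1 - exp (- l * enn2real (\<integral>\<^sup>+Z. emeasure (subspace_lborel ((direction Z)\<^sup>\<bottom>))
      (uminus ` cross_section Z + perp_proj (direction Z) ` B) \<partial>\<theta>))"
proof -
  let ?A = "{Z \<in> cylinders k. Z \<inter> B \<noteq> {}}"
  let ?I = "\<integral>\<^sup>+Z. emeasure (subspace_lborel ((direction Z)\<^sup>\<bottom>))
      (uminus ` cross_section Z + perp_proj (direction Z) ` B) \<partial>\<theta>"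
  have sets: "sets \<Lambda> = sets (cylinder_algebra k)" and lf: "locally_finite \<Lambda>"
    and pp: "poisson_process M \<Lambda> \<Xi>"
    using assms(2) by (auto simp: poisson_cylinder_process_def)
  have space: "space \<Lambda> = cylinders k"
    using sets_eq_imp_space_eq[OF sets] by (simp add: space_cylinder_algebra)
  interpret prob_space M
    using pp by (simp add: poisson_process_def)
  have A: "?A \<in> sets \<Lambda>"
    using hitting_cylinders_measurable[OF assms(6)] sets by simp
  have meas: "\<Xi> \<in> M \<rightarrow>\<^sub>M counting_algebra \<Lambda>"
    using pp by (simp add: poisson_process_def)
  have single: "{Z} \<in> sets \<Lambda>" if "Z \<in> space \<Lambda>" for Z
    using that singleton_cylinder_measurable sets space by simp
  have hit: "union_set \<Xi> \<omega> \<inter> B \<noteq> {} \<longleftrightarrow> emeasure (\<Xi> \<omega>) ?A \<noteq> 0" if \<omega>: "\<omega> \<in> space M" for \<omega>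
  proof -
    have N: "\<Xi> \<omega> \<in> counting_measures \<Lambda>"
      using measurable_space[OF meas \<omega>] by (simp add: space_counting_algebra)
    then have "space (\<Xi> \<omega>) = cylinders k"
      using space by (auto simp: counting_measures_def)
    then have "union_set \<Xi> \<omega> \<inter> B \<noteq> {} \<longleftrightarrow> support (\<Xi> \<omega>) \<inter> ?A \<noteq> {}"
      unfolding union_set_def support_def by blast
    also have "\<dots> \<longleftrightarrow> emeasure (\<Xi> \<omega>) ?A \<noteq> 0"
      using N A single by (rule support_meets_iff)
    finally show ?thesis .
  qed
  have "(\<lambda>\<omega>. emeasure (\<Xi> \<omega>) ?A) \<in> borel_measurable M"
    by (rule measurable_compose[OF meas measurable_emeasure_counting_algebra[OF A]])
  then have void_event: "{\<omega> \<in> space M. emeasure (\<Xi> \<omega>) ?A = 0} \<in> sets M"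
    by measurable
  have "emeasure \<Lambda> ?A < \<infinity>"
    using lf assms(6) unfolding locally_finite_def space by blast
  then have void: "prob {\<omega> \<in> space M. emeasure (\<Xi> \<omega>) ?A = 0} = exp (- measure \<Lambda> ?A)"
    by (intro void_probability[OF pp A] less_imp_neq)
  have "{\<omega> \<in> space M. union_set \<Xi> \<omega> \<inter> B \<noteq> {}} =
      space M - {\<omega> \<in> space M. emeasure (\<Xi> \<omega>) ?A = 0}"
    using hit by blast
  then have "capacity_functional M (union_set \<Xi>) B = 1 - exp (- measure \<Lambda> ?A)"
    unfolding capacity_functional_def using prob_compl[OF void_event] void by simp
  moreover have "measure \<Lambda> ?A = l * enn2real ?I"
    using intensity_hitting_cylinders[OF sets assms(5,6)] assms(5)
    by (simp add: measure_def enn2real_mult intensity_and_shape_def)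
  ultimately show ?thesis
    by simp
qed

end
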